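(* Let $n$ be a positive integer and let $\mu\in\mathbb{C}^n$ be generic. Then every local derivation on the (centerless) generalized Virasoro algebra $W_n(\mu)$ is a derivation of the Lie algebra $W_n(\mu)$.
   Context: All algebras are over $\mathbb{C}$. Let $A_n=\mathbb{C}[t_1^{\pm1},\dots,t_n^{\pm1}]$ and let $W_n=\mathrm{Der}(A_n)$ be the Lie algebra of all $\mathbb{C}$-linear derivations of $A_n$, with the commutator bracket. Put $d_i=t_i\frac{\partial}{\partial t_i}$. A vector $\mu=(\mu_1,\dots,\mu_n)\in\mathbb{C}^n$ is generic if $\mu\cdot\alpha=\sum_i\mu_i\alpha_i\neq0$ for all $\alpha\in\mathbb{Z}^n\setminus\{0\}$. For generic $\mu$ put $d_\mu=\mu_1d_1+\cdots+\mu_nd_n$. The (centerless) generalized Virasoro algebra of rank $n$ is the Lie subalgebra $W_n(\mu)=A_nd_\mu$ of $W_n$. A derivation on a Lie algebra $L$ is a linear map $D:L\to L$ with $D([x,y])=[D(x),y]+[x,D(y)]$ for all $x,y\in L$. A local derivation on $L$ is a linear map $\Delta:L\to L$ such that for every $x\in L$ there exists a derivation $D_x:L\to L$ (depending on $x$) with $\Delta(x)=D_x(x)$. *)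

theory Defs
  imports
    "HOL-Analysis.Analysis"
    "HOL-Library.Poly_Mapping"
    "HOL-Library.Function_Algebras"
begin

text \<open>
  The Laurent polynomial algebra \<open>A\<^sub>n\<close> is the group algebra of the lattice \<open>int ^ 'n\<close>: finitely
  supported coefficient families with the convolution product of
  \<^theory>\<open>HOL-Library.Poly_Mapping\<close>. The monomial with exponent \<open>\<alpha>\<close> is \<open>Poly_Mapping.single \<alpha> 1\<close>.
  The index type \<open>'n\<close> is finite and nonempty, so \<open>n = CARD('n) \<ge> 1\<close> is arbitrary.
\<close>

type_synonym 'n laurent = "(int ^ 'n) \<Rightarrow>\<^sub>0 complex"

definition lscale :: "complex \<Rightarrow> 'n::finite laurent \<Rightarrow> 'n laurent" where
  "lscale c f = Poly_Mapping.map ((*) c) f"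

definition opscale :: "complex \<Rightarrow> ('n::finite laurent \<Rightarrow> 'n laurent) \<Rightarrow> 'n laurent \<Rightarrow> 'n laurent" where
  "opscale c D = (\<lambda>f. lscale c (D f))"

text \<open>
  Algebras are given by a scalar multiplication \<open>s\<close>, a product \<open>m\<close> and a carrier \<open>L\<close> inside an
  ambient additive group. A derivation is a map of the ambient type of which only the restriction
  to \<open>L\<close> matters. Taking for \<open>m\<close> the product of \<open>A\<^sub>n\<close> or a Lie bracket gives the
  two kinds of derivations needed here.
\<close>

definition linear_endo_on ::
  "(complex \<Rightarrow> 'v \<Rightarrow> 'v) \<Rightarrow> 'v::ab_group_add set \<Rightarrow> ('v \<Rightarrow> 'v) \<Rightarrow> bool" where
  "linear_endo_on s L T \<longleftrightarrow>
     (\<forall>x\<in>L. T x \<in> L) \<and>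
     (\<forall>x\<in>L. \<forall>y\<in>L. T (x + y) = T x + T y) \<and>
     (\<forall>c. \<forall>x\<in>L. T (s c x) = s c (T x))"

definition derivation_on ::
  "(complex \<Rightarrow> 'v \<Rightarrow> 'v) \<Rightarrow> ('v \<Rightarrow> 'v \<Rightarrow> 'v) \<Rightarrow> 'v::ab_group_add set \<Rightarrow> ('v \<Rightarrow> 'v) \<Rightarrow> bool" where
  "derivation_on s m L D \<longleftrightarrow>
     linear_endo_on s L D \<and> (\<forall>x\<in>L. \<forall>y\<in>L. D (m x y) = m (D x) y + m x (D y))"

definition local_derivation_on ::
  "(complex \<Rightarrow> 'v \<Rightarrow> 'v) \<Rightarrow> ('v \<Rightarrow> 'v \<Rightarrow> 'v) \<Rightarrow> 'v::ab_group_add set \<Rightarrow> ('v \<Rightarrow> 'v) \<Rightarrow> bool" where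
  "local_derivation_on s m L \<Delta> \<longleftrightarrow>
     linear_endo_on s L \<Delta> \<and> (\<forall>x\<in>L. \<exists>D. derivation_on s m L D \<and> \<Delta> x = D x)"

definition subalgebra_on ::
  "(complex \<Rightarrow> 'v \<Rightarrow> 'v) \<Rightarrow> ('v \<Rightarrow> 'v \<Rightarrow> 'v) \<Rightarrow> 'v::ab_group_add set \<Rightarrow> bool" where
  "subalgebra_on s m L \<longleftrightarrow>
     0 \<in> L \<and> (\<forall>x\<in>L. \<forall>y\<in>L. x + y \<in> L) \<and> (\<forall>c. \<forall>x\<in>L. s c x \<in> L) \<and> (\<forall>x\<in>L. \<forall>y\<in>L. m x y \<in> L)"

definition commutator :: "('v::ab_group_add \<Rightarrow> 'v) \<Rightarrow> ('v \<Rightarrow> 'v) \<Rightarrow> 'v \<Rightarrow> 'v" where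
  "commutator D E = (D \<circ> E) - (E \<circ> D)"

definition witt_algebra :: "('n::finite laurent \<Rightarrow> 'n laurent) set" where
  "witt_algebra = {D. derivation_on lscale (*) UNIV D}"

definition lvar :: "'n \<Rightarrow> 'n::finite laurent" where
  "lvar i = Poly_Mapping.single (axis i 1) 1"

text \<open>The linear extension of \<open>t\<^sup>\<alpha> \<mapsto> \<alpha>\<^sub>i t\<^sup>\<alpha> / t\<^sub>i\<close>.\<close>

definition lpartial :: "'n \<Rightarrow> 'n::finite laurent \<Rightarrow> 'n laurent" where
  "lpartial i f =
     (\<Sum>\<alpha>\<in>Poly_Mapping.keys f.
        Poly_Mapping.single (\<alpha> - axis i 1) (of_int (\<alpha> $ i) * Poly_Mapping.lookup f \<alpha>))"

definition ldeg :: "'n \<Rightarrow> 'n::finite laurent \<Rightarrow> 'n laurent" where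
  "ldeg i f = lvar i * lpartial i f"

definition generic :: "complex ^ 'n::finite \<Rightarrow> bool" where
  "generic \<mu> \<longleftrightarrow> (\<forall>\<alpha> :: int ^ 'n. \<alpha> \<noteq> 0 \<longrightarrow> (\<Sum>i\<in>UNIV. \<mu> $ i * of_int (\<alpha> $ i)) \<noteq> 0)"

definition dmu :: "complex ^ 'n \<Rightarrow> 'n::finite laurent \<Rightarrow> 'n laurent" where
  "dmu \<mu> = (\<Sum>i\<in>UNIV. opscale (\<mu> $ i) (ldeg i))"

definition gen_virasoro :: "complex ^ 'n \<Rightarrow> ('n::finite laurent \<Rightarrow> 'n laurent) set" where
  "gen_virasoro \<mu> = {(\<lambda>f. a * dmu \<mu> f) | a. True}"

subsection \<open>The set \<open>gen_virasoro \<mu>\<close> is a Lie subalgebra of \<open>witt_algebra\<close>\<close>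

lemma lscale_conv_mult: "lscale c f = Poly_Mapping.single 0 c * f"
  by (simp add: lscale_def mult_map_scale_conv_mult)

lemma lookup_lpartial:
  "Poly_Mapping.lookup (lpartial i f) \<beta> =
     of_int (\<beta> $ i + 1) * Poly_Mapping.lookup f (\<beta> + axis i 1)"
proof -
  have "Poly_Mapping.lookup (lpartial i f) \<beta> =
      (\<Sum>\<alpha>\<in>Poly_Mapping.keys f.
         if \<alpha> = \<beta> + axis i 1 then of_int (\<alpha> $ i) * Poly_Mapping.lookup f \<alpha> else 0)"
    unfolding lpartial_def lookup_sum
    by (intro sum.cong) (auto simp: lookup_single when_def algebra_simps)
  then show ?thesis
    by (auto simp: in_keys_iff axis_def)
qed

lemma lpartial_add: "lpartial i (f + g) = lpartial i f + lpartial i g"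
  by (rule poly_mapping_eqI) (simp add: lookup_lpartial lookup_add algebra_simps)

lemma ldeg_add: "ldeg i (f + g) = ldeg i f + ldeg i g"
  by (simp add: ldeg_def lpartial_add algebra_simps)

lemma ldeg_single: "ldeg i (Poly_Mapping.single \<alpha> c) = Poly_Mapping.single \<alpha> (of_int (\<alpha> $ i) * c)"
  by (cases "c = 0") (auto simp: ldeg_def lpartial_def lvar_def mult_single)

lemma laurent_induct:
  fixes f :: "'n::finite laurent"
  assumes "P 0" "\<And>\<alpha> c. P (Poly_Mapping.single \<alpha> c)" "\<And>f g. P f \<Longrightarrow> P g \<Longrightarrow> P (f + g)"
  shows "P f"
proof (induction f rule: update_induct)
  case const
  then show ?case using assms(1) by simp
next
  case (update f a b)
  have "Poly_Mapping.update a b f = Poly_Mapping.single a b + f"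
    using update.hyps
    by (intro poly_mapping_eqI)
       (auto simp: lookup_update lookup_add lookup_single when_def in_keys_iff)
  then show ?case using assms update by auto
qed

lemma ldeg_zero: "ldeg i 0 = 0"
  by (simp add: ldeg_def lpartial_def)

lemma ldeg_mult: "ldeg i (f * g) = ldeg i f * g + f * ldeg i g"
proof (induction f rule: laurent_induct)
  case (2 \<alpha> c)
  show ?case
    by (induction g rule: laurent_induct)
       (auto simp: ldeg_zero ldeg_add ldeg_single mult_single algebra_simps simp flip: single_add)
qed (auto simp: ldeg_zero ldeg_add algebra_simps)

lemma dmu_apply: "dmu \<mu> f = (\<Sum>i\<in>UNIV. Poly_Mapping.single 0 (\<mu> $ i) * ldeg i f)"
proof -
  have "sum F I x = (\<Sum>i\<in>I. F i x)" for F :: "'c \<Rightarrow> 'd \<Rightarrow> 'e::comm_monoid_add" and I x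
    by (induction I rule: infinite_finite_induct) auto
  then show ?thesis by (simp add: dmu_def opscale_def lscale_conv_mult)
qed

lemma dmu_add: "dmu \<mu> (f + g) = dmu \<mu> f + dmu \<mu> g"
  by (simp add: dmu_apply ldeg_add algebra_simps sum.distrib)

lemma dmu_mult: "dmu \<mu> (f * g) = dmu \<mu> f * g + f * dmu \<mu> g"
  by (simp add: dmu_apply ldeg_mult algebra_simps sum.distrib sum_distrib_left)

lemma dmu_const: "dmu \<mu> (Poly_Mapping.single 0 c) = 0"
  by (simp add: dmu_apply ldeg_single)

lemma gen_virasoro_subset: "gen_virasoro \<mu> \<subseteq> witt_algebra"
  by (auto simp: gen_virasoro_def witt_algebra_def derivation_on_def linear_endo_on_def
      lscale_conv_mult dmu_add dmu_mult dmu_const algebra_simps)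

lemma gen_virasoro_subalgebra: "subalgebra_on opscale commutator (gen_virasoro \<mu>)"
proof -
  have "(\<lambda>f. 0 * dmu \<mu> f) \<in> gen_virasoro \<mu>"
    unfolding gen_virasoro_def by blast
  then have "0 \<in> gen_virasoro \<mu>"
    by (simp add: zero_fun_def)
  moreover have "(\<lambda>f. a * dmu \<mu> f) + (\<lambda>f. b * dmu \<mu> f) = (\<lambda>f. (a + b) * dmu \<mu> f)" for a b
    by (auto simp: algebra_simps)
  moreover have "opscale c (\<lambda>f. a * dmu \<mu> f) = (\<lambda>f. (Poly_Mapping.single 0 c * a) * dmu \<mu> f)" for a c
    by (simp add: opscale_def lscale_conv_mult mult.assoc)
  moreover have "commutator (\<lambda>f. a * dmu \<mu> f) (\<lambda>f. b * dmu \<mu> f) =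
      (\<lambda>f. (a * dmu \<mu> b - b * dmu \<mu> a) * dmu \<mu> f)" for a b
  proof (rule ext)
    fix f
    have "commutator (\<lambda>f. a * dmu \<mu> f) (\<lambda>f. b * dmu \<mu> f) f =
        a * dmu \<mu> (b * dmu \<mu> f) - b * dmu \<mu> (a * dmu \<mu> f)"
      by (simp add: commutator_def)
    also have "\<dots> = (a * dmu \<mu> b - b * dmu \<mu> a) * dmu \<mu> f"
      by (simp add: dmu_mult algebra_simps)
    finally show "commutator (\<lambda>f. a * dmu \<mu> f) (\<lambda>f. b * dmu \<mu> f) f =
        (a * dmu \<mu> b - b * dmu \<mu> a) * dmu \<mu> f" .
  qed
  ultimately show ?thesis
    unfolding subalgebra_on_def gen_virasoro_def by auto
qed

end

theory Submission
  imports Defs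
begin

text \<open>
  Write \<open>X a\<close> for \<open>t\<^sup>a d\<^sub>\<mu>\<close> and \<open>\<phi> a = \<mu> \<cdot> a\<close>, so that \<open>[X a, X b] = (\<phi> b - \<phi> a) X (a + b)\<close> with \<open>\<phi>\<close>
  additive and injective. After subtracting an inner derivation, a derivation is diagonal on
  \<open>X 0\<close>, hence diagonal: every derivation is inner plus \<open>X a \<mapsto> h a X a\<close> with \<open>h\<close> additive.

  A local derivation \<open>\<Delta>\<close> may therefore be assumed to kill \<open>X 0\<close>. The vectors \<open>X m + c X 0\<close> with
  \<open>c \<noteq> 0\<close> all have the image \<open>\<Delta> (X m)\<close>. On each coset of the multiples of \<open>m\<close> this gives a two-term
  recurrence with a finitely supported solution; eliminating the solution leaves a polynomial
  in \<open>c\<close> that vanishes for all \<open>c \<noteq> 0\<close>, and its coefficients force \<open>\<Delta> (X m) = g m X m\<close>.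

  Order the lattice by an additive injection into the reals. If \<open>x\<close> is a sum of vectors \<open>X s\<close>
  for \<open>s \<in> {a, b, a + b}\<close> with \<open>a, b > 0\<close>, or for \<open>s \<in> {a, - a}\<close>, then comparing leading and trailing
  terms in \<open>\<Delta> x = [u, x] + grade h x\<close> shows that \<open>u\<close> acts on \<open>x\<close> as a multiple of \<open>X 0\<close>. Hence \<open>g\<close> agrees
  with an additive map on these sets, and so \<open>g\<close> is additive.
\<close>

section \<open>Coefficients and gradings in group algebras\<close>

lemma poly_mapping_add_induct [case_names zero single add]:
  fixes f :: "'g \<Rightarrow>\<^sub>0 'b::comm_monoid_add"
  assumes "P 0" "\<And>a c. P (Poly_Mapping.single a c)" "\<And>f g. P f \<Longrightarrow> P g \<Longrightarrow> P (f + g)"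
  shows "P f"
proof (induction f rule: update_induct)
  case const
  then show ?case using assms(1) by simp
next
  case (update f a b)
  have "Poly_Mapping.update a b f = Poly_Mapping.single a b + f"
    using update.hyps
    by (intro poly_mapping_eqI)
       (auto simp: lookup_update lookup_add lookup_single when_def in_keys_iff)
  then show ?case using assms update by auto
qed

lemma lookup_mult_single:
  fixes f :: "'g::ab_group_add \<Rightarrow>\<^sub>0 'b::semiring_0"
  shows "Poly_Mapping.lookup (f * Poly_Mapping.single m c) b = Poly_Mapping.lookup f (b - m) * c"
  by (induction f rule: poly_mapping_add_induct)
     (auto simp: mult_single lookup_single lookup_add distrib_right when_def algebra_simps)

lemma lookup_single_mult:
  fixes f :: "'g::ab_group_add \<Rightarrow>\<^sub>0 'b::semiring_0"
  shows "Poly_Mapping.lookup (Poly_Mapping.single m c * f) b = c * Poly_Mapping.lookup f (b - m)"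
  by (induction f rule: poly_mapping_add_induct)
     (auto simp: mult_single lookup_single lookup_add distrib_left when_def algebra_simps)

text \<open>For additive \<open>h\<close> this is the degree derivation, and
  \<open>h = \<phi>\<close> gives \<open>d\<^sub>\<mu>\<close>. Other \<open>h\<close> are allowed
  so that \<open>grade \<phi>\<close> can be inverted away from exponent \<open>0\<close>.\<close>

definition grade :: "('g \<Rightarrow> complex) \<Rightarrow> ('g \<Rightarrow>\<^sub>0 complex) \<Rightarrow> 'g \<Rightarrow>\<^sub>0 complex" where
  "grade h = Poly_Mapping.mapp (\<lambda>a c. h a * c)"

lemma lookup_grade: "Poly_Mapping.lookup (grade h f) a = h a * Poly_Mapping.lookup f a"
  by (auto simp: grade_def lookup_mapp when_def in_keys_iff)

lemma grade_zero [simp]: "grade h 0 = 0"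
  by (rule poly_mapping_eqI) (simp add: lookup_grade)

lemma grade_add: "grade h (f + g) = grade h f + grade h g"
  by (rule poly_mapping_eqI) (simp add: lookup_grade lookup_add algebra_simps)

lemma grade_minus: "grade h (f - g) = grade h f - grade h g"
  by (rule poly_mapping_eqI) (simp add: lookup_grade lookup_minus algebra_simps)

lemma grade_single: "grade h (Poly_Mapping.single a c) = Poly_Mapping.single a (h a * c)"
  by (rule poly_mapping_eqI) (simp add: lookup_grade lookup_single when_def)

lemma grade_commute: "grade h (grade k f) = grade k (grade h f)"
  by (rule poly_mapping_eqI) (simp add: lookup_grade)

lemma grade_mult:
  fixes h :: "'g::ab_group_add \<Rightarrow> complex"
  assumes "Modules.additive h"
  shows "grade h (f * g) = grade h f * g + f * grade h g"
proof (induction f rule: poly_mapping_add_induct)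
  case (single a c)
  show ?case
    by (induction g rule: poly_mapping_add_induct)
       (simp_all add: grade_add grade_single mult_single algebra_simps Modules.additive.add[OF assms]
         flip: single_add)
qed (auto simp: grade_add algebra_simps)

text \<open>Written as a product with a constant, so that ring simplification also handles
  scalars.\<close>

definition pscale :: "complex \<Rightarrow> ('g::ab_group_add \<Rightarrow>\<^sub>0 complex) \<Rightarrow> 'g \<Rightarrow>\<^sub>0 complex" where
  "pscale c f = Poly_Mapping.single 0 c * f"

lemma lookup_pscale: "Poly_Mapping.lookup (pscale c f) b = c * Poly_Mapping.lookup f b"
  by (simp add: pscale_def lookup_single_mult)

lemma grade_pscale: "grade h (pscale c f) = pscale c (grade h f)"
  by (rule poly_mapping_eqI) (simp add: lookup_grade lookup_pscale)

lemma pscale_single: "pscale c (Poly_Mapping.single a d) = Poly_Mapping.single a (c * d)"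
  by (simp add: pscale_def mult_single)

lemma linear_endo_on_eqI:
  assumes S: "linear_endo_on pscale UNIV S" and T: "linear_endo_on pscale UNIV T"
    and eq: "\<And>a. S (Poly_Mapping.single a 1) = T (Poly_Mapping.single a 1)"
  shows "S x = T x"
proof (induction x rule: poly_mapping_add_induct)
  case zero
  have "S (pscale 0 0) = pscale 0 (S 0)" "T (pscale 0 0) = pscale 0 (T 0)"
    using S T by (simp_all add: linear_endo_on_def)
  then show ?case by (simp add: pscale_def)
next
  case (single a c)
  have "S (pscale c (Poly_Mapping.single a 1)) = T (pscale c (Poly_Mapping.single a 1))"
    using S T eq by (simp add: linear_endo_on_def)
  then show ?case by (simp add: pscale_single)
next
  case (add f g)
  then show ?case using S T by (simp add: linear_endo_on_def)
qed

text \<open>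
  With \<open>r K = (\<Prod>j<K. - q j / p j)\<close> the combination \<open>\<Sum>k\<le>K. r k * w k * c ^ k\<close> telescopes to a multiple
  of \<open>u K\<close>, which is \<open>0\<close> for large \<open>K\<close>. The solution \<open>u\<close> may depend on \<open>c\<close>, but \<open>w\<close> does not.
\<close>
lemma recurrence_family_vanishes:
  fixes p q w :: "nat \<Rightarrow> complex"
  assumes p: "\<And>k. p k \<noteq> 0" and q: "\<And>k. q k \<noteq> 0" and w: "finite {k. w k \<noteq> 0}"
    and u: "\<And>c. c \<noteq> 0 \<Longrightarrow> \<exists>u. finite {k. u k \<noteq> 0} \<and> w 0 = c * q 0 * u 0 \<and>
               (\<forall>k. w (Suc k) = p k * u k + c * q (Suc k) * u (Suc k))"
  shows "w n = 0"
proof -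
  define r where "r K = (\<Prod>j<K. - q j / p j)" for K
  have r0: "r K \<noteq> 0" for K
    using p q by (simp add: r_def)
  have rS: "r (Suc K) * p K = - r K * q K" for K
    using p[of K] by (simp add: r_def)
  obtain N where N: "\<And>k. w k \<noteq> 0 \<Longrightarrow> k \<le> N"
    using w by (metis (mono_tags, lifting) finite_nat_set_iff_bounded_le mem_Collect_eq)
  have root: "(\<Sum>k\<le>N. (r k * w k) * c ^ k) = 0" if c: "c \<noteq> 0" for c
  proof -
    obtain u where fu: "finite {k. u k \<noteq> 0}" and u0: "w 0 = c * q 0 * u 0"
      and uS: "\<And>k. w (Suc k) = p k * u k + c * q (Suc k) * u (Suc k)"
      using u[OF c] by blast
    have tele: "(\<Sum>k\<le>K. (r k * w k) * c ^ k) = c ^ Suc K * r K * q K * u K" for K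
    proof (induction K)
      case 0
      then show ?case by (simp add: u0 r_def)
    next
      case (Suc K)
      have "(\<Sum>k\<le>Suc K. (r k * w k) * c ^ k) =
          c ^ Suc K * u K * (r K * q K + r (Suc K) * p K)
          + c ^ Suc (Suc K) * r (Suc K) * q (Suc K) * u (Suc K)"
        unfolding sum.atMost_Suc Suc.IH uS by (simp add: algebra_simps)
      then show ?case by (simp add: rS)
    qed
    obtain N' where N': "\<And>k. u k \<noteq> 0 \<Longrightarrow> k \<le> N'"
      using fu by (metis (mono_tags, lifting) finite_nat_set_iff_bounded_le mem_Collect_eq)
    \<comment> \<open>\<open>K\<close> lies beyond both supports: past \<open>N'\<close> the
      telescoped side is \<open>0\<close>, and past \<open>N\<close> the sum gains no terms. Cutting
      back to \<open>N\<close> leaves one polynomial for all \<open>c\<close>, although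
      \<open>N'\<close> depends on \<open>c\<close>.\<close>
    define K where "K = Suc (N + N')"
    have "u K = 0"
      using N'[of K] by (auto simp: K_def)
    then have "(\<Sum>k\<le>K. (r k * w k) * c ^ k) = 0"
      unfolding tele by simp
    also have "(\<Sum>k\<le>K. (r k * w k) * c ^ k) = (\<Sum>k\<le>N. (r k * w k) * c ^ k)"
      using N by (intro sum.mono_neutral_right) (force simp: K_def)+
    finally show ?thesis .
  qed
  then have "UNIV - {0} \<subseteq> {c. (\<Sum>k\<le>N. (r k * w k) * c ^ k) = 0}"
    by auto
  then have "infinite {c. (\<Sum>k\<le>N. (r k * w k) * c ^ k) = 0}"
    by (rule infinite_super) (rule Diff_infinite_finite[OF _ infinite_UNIV_char_0], simp)
  then have "\<forall>k\<le>N. r k * w k = 0"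
    using polyfun_finite_roots[where c = "\<lambda>k. r k * w k" and n = N] by simp
  then show ?thesis using r0[of n] N[of n] by auto
qed

section \<open>Orderings of the lattice and leading terms\<close>

lemma additive_real_embedding:
  fixes \<phi> :: "'g::{ab_group_add, countable} \<Rightarrow> complex"
  assumes "Modules.additive \<phi>" "inj \<phi>"
  obtains \<rho> :: "'g \<Rightarrow> real" where "Modules.additive \<rho>" "inj \<rho>"
proof -
  interpret Modules.additive \<phi> by fact
  have nz: "\<phi> a \<noteq> 0" if "a \<noteq> 0" for a
    using that \<open>inj \<phi>\<close> zero by (metis injD)
  \<comment> \<open>Project to a real line: each \<open>a \<noteq> 0\<close> excludes at most one slope \<open>t\<close>.\<close>
  define bad where "bad = (\<lambda>a. Re (\<phi> a) / Im (\<phi> a)) ` (UNIV :: 'g set)"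
  have "bad \<noteq> UNIV"
    using uncountable_UNIV_real unfolding bad_def by (metis countable_image countableI_type)
  then obtain t where t: "t \<notin> bad" by blast
  define \<rho> where "\<rho> a = Re (\<phi> a) - t * Im (\<phi> a)" for a
  have "Modules.additive \<rho>"
    by unfold_locales (simp add: \<rho>_def add algebra_simps)
  moreover have "a = 0" if "\<rho> a = 0" for a
  proof (rule ccontr)
    assume "a \<noteq> 0"
    then have "\<phi> a \<noteq> 0" by (rule nz)
    then have "Im (\<phi> a) \<noteq> 0"
      using that by (auto simp: \<rho>_def complex_eq_iff)
    then have "t = Re (\<phi> a) / Im (\<phi> a)"
      using that by (simp add: \<rho>_def field_simps)
    then show False using t by (auto simp: bad_def)
  qed
  ultimately have "inj \<rho>"
    by (metis (no_types, opaque_lifting) Modules.additive.diff eq_iff_diff_eq_0 injI)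
  then show thesis using \<open>Modules.additive \<rho>\<close> that by blast
qed

text \<open>The sums in \<open>vanish\<close> are the coefficients outside \<open>S\<close> of the
  bracket of \<open>u\<close> with the sum of the basis vectors over \<open>S\<close>. If the top
  exponent \<open>P\<close> of \<open>u\<close> were positive, only \<open>m = M\<close> would
  contribute at \<open>P + M\<close>, with factor \<open>\<phi> M - \<phi> P\<close>. Hence
  \<open>P = M\<close>, which \<open>top\<close> excludes.\<close>

lemma max_support_bound:
  fixes \<rho> :: "'g::ab_group_add \<Rightarrow> real" and u :: "'g \<Rightarrow>\<^sub>0 complex"
  assumes "Modules.additive \<rho>" "inj \<rho>" and \<phi>: "Modules.additive \<phi>" "inj (\<phi> :: 'g \<Rightarrow> complex)"
    and S: "finite S" "M \<in> S" and max: "\<And>m. m \<in> S \<Longrightarrow> \<rho> m \<le> \<rho> M"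
    and vanish: "\<And>b. b \<notin> S \<Longrightarrow> (\<Sum>m\<in>S. (2 * \<phi> m - \<phi> b) * Poly_Mapping.lookup u (b - m)) = 0"
    and top: "Poly_Mapping.lookup u M = 0 \<or> \<rho> M \<le> 0"
    and p: "Poly_Mapping.lookup u p \<noteq> 0"
  shows "\<rho> p \<le> 0"
proof (rule ccontr)
  interpret \<rho>: Modules.additive \<rho> by fact
  interpret \<phi>: Modules.additive \<phi> by fact
  assume "\<not> \<rho> p \<le> 0"
  have "Max (\<rho> ` Poly_Mapping.keys u) \<in> \<rho> ` Poly_Mapping.keys u"
    using p by (intro Max_in) (auto simp: in_keys_iff)
  then obtain P where P_keys: "P \<in> Poly_Mapping.keys u" and P_max: "Max (\<rho> ` Poly_Mapping.keys u) = \<rho> P"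
    by blast
  have P: "Poly_Mapping.lookup u P \<noteq> 0" "\<And>a. Poly_Mapping.lookup u a \<noteq> 0 \<Longrightarrow> \<rho> a \<le> \<rho> P"
    using P_keys by (auto simp: in_keys_iff simp flip: P_max)
  have pos: "\<rho> P > 0"
    using P(2)[OF p] \<open>\<not> \<rho> p \<le> 0\<close> by simp
  have "P \<noteq> M"
    using top P(1) pos by auto
  have "P + M \<notin> S"
    using max[of "P + M"] pos by (auto simp: \<rho>.add)
  have "Poly_Mapping.lookup u (P + M - m) = 0" if m: "m \<in> S - {M}" for m
  proof (rule ccontr)
    assume "Poly_Mapping.lookup u (P + M - m) \<noteq> 0"
    then have "\<rho> M \<le> \<rho> m"
      using P(2)[of "P + M - m"] by (simp add: \<rho>.add \<rho>.diff)
    then have "\<rho> M = \<rho> m"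
      using max[of m] m by simp
    then show False
      using \<open>inj \<rho>\<close> m by (auto dest: injD)
  qed
  then have "(\<Sum>m\<in>S. (2 * \<phi> m - \<phi> (P + M)) * Poly_Mapping.lookup u (P + M - m)) =
      (2 * \<phi> M - \<phi> (P + M)) * Poly_Mapping.lookup u P"
    using S by (subst sum.remove[of S M]) auto
  then have "2 * \<phi> M - \<phi> (P + M) = 0"
    using vanish[OF \<open>P + M \<notin> S\<close>] P(1) by simp
  then have "\<phi> P = \<phi> M"
    by (simp add: \<phi>.add)
  then show False
    using \<open>P \<noteq> M\<close> \<open>inj \<phi>\<close> by (auto dest: injD)
qed

section \<open>The Lie algebra on the coefficients of \<open>d\<^sub>\<mu>\<close>\<close>

locale rank_one_witt =
  fixes \<phi> :: "'g::{ab_group_add, countable} \<Rightarrow> complex"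
  assumes additive_phi: "Modules.additive \<phi>" and inj_phi: "inj \<phi>"
    and nontrivial: "\<exists>a::'g. a \<noteq> 0"
begin

sublocale phi: Modules.additive \<phi>
  by (rule additive_phi)

lemma phi_eq_iff: "\<phi> a = \<phi> b \<longleftrightarrow> a = b"
  using inj_phi by (auto dest: injD)

lemma phi_eq_0_iff: "\<phi> a = 0 \<longleftrightarrow> a = 0"
  using phi_eq_iff[of a 0] by (simp add: phi.zero)

text \<open>The commutator of \<open>f d\<^sub>\<mu>\<close> and \<open>g d\<^sub>\<mu>\<close>,
  with the common right factor \<open>d\<^sub>\<mu>\<close> removed.\<close>

definition bracket :: "('g \<Rightarrow>\<^sub>0 complex) \<Rightarrow> ('g \<Rightarrow>\<^sub>0 complex) \<Rightarrow> 'g \<Rightarrow>\<^sub>0 complex" where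
  "bracket f g = f * grade \<phi> g - g * grade \<phi> f"

abbreviation X :: "'g \<Rightarrow> 'g \<Rightarrow>\<^sub>0 complex" where
  "X a \<equiv> Poly_Mapping.single a 1"

lemma bracket_add_right: "bracket f (g + g') = bracket f g + bracket f g'"
  and bracket_diff_left: "bracket (f - f') g = bracket f g - bracket f' g"
  and bracket_diff_right: "bracket f (g - g') = bracket f g - bracket f g'"
  and bracket_pscale_left: "bracket (pscale c f) g = pscale c (bracket f g)"
  and bracket_pscale_right: "bracket f (pscale c g) = pscale c (bracket f g)"
  and bracket_self: "bracket f f = 0"
  and bracket_zero_right: "bracket f 0 = 0"
  by (simp_all add: bracket_def grade_add grade_minus grade_pscale algebra_simps)
     (simp_all add: pscale_def algebra_simps)

lemma bracket_sum_right: "bracket f (\<Sum>i\<in>I. g i) = (\<Sum>i\<in>I. bracket f (g i))"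
  by (induction I rule: infinite_finite_induct) (simp_all add: bracket_zero_right bracket_add_right)

lemma bracket_X_X: "bracket (X a) (X b) = Poly_Mapping.single (a + b) (\<phi> b - \<phi> a)"
  by (simp add: bracket_def grade_single mult_single add.commute[of b a] flip: single_diff)

text \<open>The factor is \<open>\<phi> m - \<phi> (b - m)\<close>, so it vanishes exactly at
  \<open>b = m + m\<close>. It is the source of the two-term recurrences.\<close>

lemma lookup_bracket_X:
  "Poly_Mapping.lookup (bracket f (X m)) b = (2 * \<phi> m - \<phi> b) * Poly_Mapping.lookup f (b - m)"
  by (simp add: bracket_def grade_single lookup_minus lookup_mult_single lookup_single_mult lookup_grade)
     (simp add: phi.diff algebra_simps)

lemma bracket_X_0_left: "bracket (X 0) f = grade \<phi> f"
  unfolding bracket_def grade_single by (simp add: phi.zero)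

lemma bracket_jacobi: "bracket u (bracket f g) = bracket (bracket u f) g + bracket f (bracket u g)"
  by (simp add: bracket_def grade_minus grade_mult[OF additive_phi] algebra_simps)

lemma linear_bracket_grade:
  "linear_endo_on pscale UNIV (\<lambda>x. bracket u x + grade h x)"
  by (simp add: linear_endo_on_def bracket_add_right bracket_pscale_right grade_add grade_pscale)
     (simp add: pscale_def algebra_simps)

text \<open>The inner part obeys the Leibniz rule by the Jacobi identity, the other part because
  \<open>grade h\<close> is a derivation of the product commuting with
  \<open>grade \<phi>\<close>.\<close>

lemma derivation_bracket_grade:
  assumes "Modules.additive h"
  shows "derivation_on pscale bracket UNIV (\<lambda>x. bracket u x + grade h x)"
  using linear_bracket_grade
  by (simp add: derivation_on_def bracket_def grade_add grade_minus grade_mult[OF assms]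
      grade_mult[OF additive_phi] grade_commute[of h \<phi>] algebra_simps)

text \<open>The missing case \<open>a = b\<close>: expand \<open>h (5a)\<close> as \<open>4a + a\<close> and as \<open>3a + 2a\<close>.\<close>
lemma almost_additive_imp_additive:
  assumes h: "\<And>a b. a \<noteq> b \<Longrightarrow> h (a + b) = h a + (h b :: complex)"
  shows "Modules.additive (h :: 'g \<Rightarrow> complex)"
proof
  fix a b :: 'g
  obtain c :: 'g where c: "c \<noteq> 0"
    using nontrivial by blast
  have h0: "h 0 = 0"
    using h[of c 0] c by simp
  show "h (a + b) = h a + h b"
  proof (cases "a = b \<and> a \<noteq> 0")
    case True
    have nz: "\<phi> a \<noteq> 0"
      using True by (auto simp: phi_eq_0_iff)
    have torsion: "a + a \<noteq> a" "a + a + a \<noteq> a" "a + a + a + a \<noteq> a" "a + a + a \<noteq> a + a"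
      using nz by (simp_all add: phi.add flip: phi_eq_iff)
    note h[OF torsion(1)] h[OF torsion(2)] h[OF torsion(3)] h[OF torsion(4)]
    from this have "h (a + a) = h a + h a"
      by (simp add: add.assoc)
    then show ?thesis using True by simp
  qed (use h h0 in auto)
qed

section \<open>Derivations in normal form\<close>

lemma derivation_classification:
  assumes D: "derivation_on pscale bracket UNIV D"
  obtains u h where "Modules.additive h" "\<And>x. D x = bracket u x + grade h x"
proof -
  define v where "v = D (X 0)"
  \<comment> \<open>\<open>1 / \<phi> 0 = 0\<close>, so \<open>u\<close> has no coefficient at \<open>0\<close>.\<close>
  define u where "u = grade (\<lambda>b. - (1 / \<phi> b)) v"
  define E where "E x = D x - bracket u x" for x
  have lin: "linear_endo_on pscale UNIV E"
    using D linear_bracket_grade[of u "\<lambda>_. 0"]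
    by (simp add: derivation_on_def linear_endo_on_def E_def bracket_add_right bracket_pscale_right)
       (simp add: pscale_def algebra_simps)
  have E_bracket: "E (bracket x y) = bracket (E x) y + bracket x (E y)" for x y
  proof -
    have "D (bracket x y) = bracket (D x) y + bracket x (D y)"
      using D by (simp add: derivation_on_def)
    then show ?thesis
      by (simp add: E_def bracket_jacobi[of u x y] bracket_diff_left bracket_diff_right)
  qed
  define v0 where "v0 = Poly_Mapping.lookup v 0"
  have E0: "E (X 0) = pscale v0 (X 0)"
    by (rule poly_mapping_eqI)
       (auto simp: E_def lookup_minus lookup_bracket_X u_def lookup_grade lookup_pscale
          lookup_single when_def phi.zero phi_eq_0_iff v0_def
          simp del: single_one simp flip: v_def)
  \<comment> \<open>Apply \<open>E\<close> to the eigenvector equation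
    \<open>bracket (X 0) (X a) = pscale (\<phi> a) (X a)\<close>. As the eigenvalues
    \<open>\<phi> a\<close> are distinct, coefficients off the diagonal must vanish.\<close>
  have E_X: "\<phi> a * Poly_Mapping.lookup (E (X a)) b =
      (v0 * \<phi> a when a = b) + \<phi> b * Poly_Mapping.lookup (E (X a)) b" for a b
  proof -
    have "E (bracket (X 0) (X a)) = pscale v0 (bracket (X 0) (X a)) + grade \<phi> (E (X a))"
      by (simp add: E_bracket E0 bracket_pscale_left bracket_X_0_left[of "E (X a)"] del: single_one)
    moreover have "bracket (X 0) (X a) = pscale (\<phi> a) (X a)"
      by (simp add: bracket_X_X phi.zero pscale_single del: single_one)
    moreover have "E (pscale (\<phi> a) (X a)) = pscale (\<phi> a) (E (X a))"
      using lin by (simp add: linear_endo_on_def)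
    ultimately have "Poly_Mapping.lookup (pscale (\<phi> a) (E (X a))) b =
        Poly_Mapping.lookup (pscale v0 (pscale (\<phi> a) (X a)) + grade \<phi> (E (X a))) b"
      by simp
    then show ?thesis
      by (simp add: lookup_add lookup_pscale lookup_grade lookup_single when_def split: if_splits)
  qed
  define h where "h a = Poly_Mapping.lookup (E (X a)) a" for a
  have E_h: "E (X a) = pscale (h a) (X a)" for a
  proof (rule poly_mapping_eqI)
    fix b
    show "Poly_Mapping.lookup (E (X a)) b = Poly_Mapping.lookup (pscale (h a) (X a)) b"
      using E_X[of a b] phi_eq_iff[of a b]
      by (cases "a = b") (simp_all add: lookup_pscale lookup_single h_def)
  qed
  \<comment> \<open>The structure constant \<open>\<phi> b - \<phi> a\<close> can be cancelled only
    for \<open>a \<noteq> b\<close>, so the bracket gives additivity just for distinct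
    arguments.\<close>
  have "Modules.additive h"
  proof (rule almost_additive_imp_additive)
    fix a b :: 'g
    assume "a \<noteq> b"
    have "E (pscale (\<phi> b - \<phi> a) (X (a + b))) = pscale (\<phi> b - \<phi> a) (E (X (a + b)))"
      using lin by (simp add: linear_endo_on_def)
    then have "pscale (\<phi> b - \<phi> a) (pscale (h (a + b)) (X (a + b))) = E (bracket (X a) (X b))"
      by (simp add: bracket_X_X E_h pscale_single)
    also have "\<dots> = pscale (h a + h b) (bracket (X a) (X b))"
      by (simp add: E_bracket E_h bracket_pscale_left bracket_pscale_right)
         (simp add: pscale_def single_add algebra_simps)
    finally have "Poly_Mapping.lookup (pscale (\<phi> b - \<phi> a) (pscale (h (a + b)) (X (a + b)))) (a + b) =
        Poly_Mapping.lookup (pscale (h a + h b) (bracket (X a) (X b))) (a + b)"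
      by simp
    then show "h (a + b) = h a + h b"
      using \<open>a \<noteq> b\<close> by (auto simp: bracket_X_X lookup_pscale phi_eq_iff)
  qed
  moreover have "E x = grade h x" for x
  proof (rule linear_endo_on_eqI[where S = E and T = "grade h"])
    show "linear_endo_on pscale UNIV (grade h)"
      using linear_bracket_grade[of 0 h] by (simp add: bracket_def)
  qed (simp_all add: lin E_h grade_single pscale_single)
  then have "D x = bracket u x + grade h x" for x
    using E_def[of x] by (simp add: algebra_simps)
  ultimately show thesis using that by blast
qed

section \<open>Recurrences along cosets of the multiples of a lattice vector\<close>

primrec nmul :: "nat \<Rightarrow> 'g \<Rightarrow> 'g" where
  "nmul 0 m = 0"
| "nmul (Suc k) m = m + nmul k m"

lemma phi_nmul: "\<phi> (nmul k m) = of_nat k * \<phi> m"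
  by (induction k) (simp_all add: phi.zero phi.add algebra_simps)

lemma nmul_eq_iff:
  assumes "m \<noteq> 0"
  shows "nmul j m = nmul k m \<longleftrightarrow> j = k"
  using assms by (auto simp: phi_nmul phi_eq_0_iff simp flip: phi_eq_iff[of "nmul j m"])

lemma finite_coset:
  fixes f :: "'g \<Rightarrow>\<^sub>0 complex"
  assumes "m \<noteq> 0"
  shows "finite {k. Poly_Mapping.lookup f (b + nmul k m) \<noteq> 0}"
    and "finite {k. Poly_Mapping.lookup f (b - nmul k m) \<noteq> 0}"
proof -
  have "inj (\<lambda>k. b + nmul k m)" "inj (\<lambda>k. b - nmul k m)"
    using assms by (auto intro!: injI simp: nmul_eq_iff)
  from this[THEN finite_vimageI[OF finite_lookup[of f]]]
  show "finite {k. Poly_Mapping.lookup f (b + nmul k m) \<noteq> 0}"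
    "finite {k. Poly_Mapping.lookup f (b - nmul k m) \<noteq> 0}"
    by (simp_all add: vimage_def)
qed

text \<open>
  The coefficients away from \<open>m\<close> of \<open>w = [u, X m + c X 0] + grade h (X m + c X 0)\<close>; there the grading
  term vanishes, since \<open>h 0 = 0\<close>.
\<close>
definition test_image :: "'g \<Rightarrow> ('g \<Rightarrow>\<^sub>0 complex) \<Rightarrow> complex \<Rightarrow> ('g \<Rightarrow>\<^sub>0 complex) \<Rightarrow> bool" where
  "test_image m w c u \<longleftrightarrow> (\<forall>b. b \<noteq> m \<longrightarrow> Poly_Mapping.lookup w b =
     (2 * \<phi> m - \<phi> b) * Poly_Mapping.lookup u (b - m) - c * \<phi> b * Poly_Mapping.lookup u b)"

text \<open>The last hypothesis removes the term entering at \<open>b0\<close>, so the upward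
  recurrence starts there. The first condition on \<open>b0\<close> keeps the factors
  \<open>q\<close> nonzero; the second keeps the factors \<open>p\<close> nonzero and the walk away
  from the excluded exponent \<open>m\<close>.\<close>

lemma upper_coset_vanishes:
  assumes m: "m \<noteq> 0"
    and b0: "\<And>k. \<phi> b0 + of_nat k * \<phi> m \<noteq> 0" "\<And>k. \<phi> b0 + of_nat k * \<phi> m \<noteq> \<phi> m"
    and u: "\<And>c. c \<noteq> 0 \<Longrightarrow> \<exists>u. test_image m w c u \<and>
      (2 * \<phi> m - \<phi> b0) * Poly_Mapping.lookup u (b0 - m) = 0"
  shows "Poly_Mapping.lookup w (b0 + nmul n m) = 0"
proof (rule recurrence_family_vanishes
    [where p = "\<lambda>k. 2 * \<phi> m - \<phi> (b0 + nmul (Suc k) m)" and q = "\<lambda>k. - \<phi> (b0 + nmul k m)"])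
  fix k
  show "2 * \<phi> m - \<phi> (b0 + nmul (Suc k) m) \<noteq> 0"
    using b0(2)[of k] by (auto simp: phi.add phi_nmul algebra_simps)
  show "- \<phi> (b0 + nmul k m) \<noteq> 0"
    using b0(1)[of k] by (simp only: phi.add phi_nmul neg_equal_0_iff_equal not_False_eq_True)
next
  show "finite {k. Poly_Mapping.lookup w (b0 + nmul k m) \<noteq> 0}"
    by (rule finite_coset[OF m])
next
  fix c :: complex
  assume "c \<noteq> 0"
  then obtain u where u: "test_image m w c u"
      "(2 * \<phi> m - \<phi> b0) * Poly_Mapping.lookup u (b0 - m) = 0"
    using u by blast
  have not_m: "b0 + nmul k m \<noteq> m" for k
    using b0(2)[of k] by (simp add: phi.add phi_nmul flip: phi_eq_iff)
  have shift: "b0 + nmul (Suc k) m - m = b0 + nmul k m" for k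
    by simp
  show "\<exists>u. finite {k. u k \<noteq> 0} \<and>
      Poly_Mapping.lookup w (b0 + nmul 0 m) = c * - \<phi> (b0 + nmul 0 m) * u 0 \<and>
      (\<forall>k. Poly_Mapping.lookup w (b0 + nmul (Suc k) m) =
        (2 * \<phi> m - \<phi> (b0 + nmul (Suc k) m)) * u k + c * - \<phi> (b0 + nmul (Suc k) m) * u (Suc k))"
  proof (intro exI conjI allI)
    show "finite {k. Poly_Mapping.lookup u (b0 + nmul k m) \<noteq> 0}"
      by (rule finite_coset[OF m])
    show "Poly_Mapping.lookup w (b0 + nmul 0 m) =
        c * - \<phi> (b0 + nmul 0 m) * Poly_Mapping.lookup u (b0 + nmul 0 m)"
      using u not_m[of 0] by (simp add: test_image_def)
    fix k
    show "Poly_Mapping.lookup w (b0 + nmul (Suc k) m) =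
        (2 * \<phi> m - \<phi> (b0 + nmul (Suc k) m)) * Poly_Mapping.lookup u (b0 + nmul k m)
        + c * - \<phi> (b0 + nmul (Suc k) m) * Poly_Mapping.lookup u (b0 + nmul (Suc k) m)"
      using u(1)[unfolded test_image_def, rule_format, OF not_m[of "Suc k"]]
      unfolding shift by simp
  qed
qed

text \<open>
  Downwards from \<open>0\<close> the parameter \<open>c\<close> multiplies the other term of the recurrence, so
  \<open>recurrence_family_vanishes\<close> is applied with \<open>1 / c\<close>.
\<close>
lemma lower_coset_vanishes:
  assumes m: "m \<noteq> 0" and u: "\<And>c. c \<noteq> 0 \<Longrightarrow> \<exists>u. test_image m w c u"
  shows "Poly_Mapping.lookup w (0 - nmul n m) = 0"
proof (rule recurrence_family_vanishes
    [where p = "\<lambda>k. (of_nat k + 1) * \<phi> m" and q = "\<lambda>k. (of_nat k + 2) * \<phi> m"])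
  fix k
  show "(of_nat k + 1) * \<phi> m \<noteq> 0" "(of_nat k + 2) * \<phi> m \<noteq> 0"
    using m of_nat_neq_0[of k, where 'a = complex] of_nat_neq_0[of "Suc k", where 'a = complex]
    by (simp_all add: phi_eq_0_iff add.commute)
next
  show "finite {k. Poly_Mapping.lookup w (0 - nmul k m) \<noteq> 0}"
    by (rule finite_coset[OF m])
next
  fix c :: complex
  assume c: "c \<noteq> 0"
  then obtain u where u: "test_image m w (1 / c) u"
    using u[of "1 / c"] by auto
  \<comment> \<open>The factor \<open>of_nat k\<close> kills the second term at
    \<open>k = 0\<close>, so the walk starts at exponent \<open>0\<close>. The solution is read one
    step lower, at \<open>0 - nmul (Suc k) m\<close>, and rescaled by \<open>1 / c\<close>.\<close>
  have w: "Poly_Mapping.lookup w (0 - nmul k m) =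
      (of_nat k + 2) * \<phi> m * Poly_Mapping.lookup u (0 - nmul (Suc k) m)
      + (1 / c) * of_nat k * \<phi> m * Poly_Mapping.lookup u (0 - nmul k m)" for k
  proof -
    have "of_nat (Suc k) * \<phi> m \<noteq> 0"
      using m by (simp only: mult_eq_0_iff of_nat_eq_0_iff phi_eq_0_iff) simp
    moreover have "\<phi> (0 - nmul k m) + of_nat k * \<phi> m = 0"
      by (simp add: phi.minus phi_nmul)
    ultimately have "\<phi> (0 - nmul k m) \<noteq> \<phi> m"
      by (auto simp: distrib_right)
    then have ne: "0 - nmul k m \<noteq> m"
      by auto
    have shift: "0 - nmul k m - m = 0 - nmul (Suc k) m"
      by (simp add: algebra_simps)
    show ?thesis
      using u[unfolded test_image_def, rule_format, OF ne] unfolding shift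
      by (simp add: phi.minus phi_nmul algebra_simps)
  qed
  show "\<exists>u. finite {k. u k \<noteq> 0} \<and>
      Poly_Mapping.lookup w (0 - nmul 0 m) = c * ((of_nat 0 + 2) * \<phi> m) * u 0 \<and>
      (\<forall>k. Poly_Mapping.lookup w (0 - nmul (Suc k) m) =
        (of_nat k + 1) * \<phi> m * u k + c * ((of_nat (Suc k) + 2) * \<phi> m) * u (Suc k))"
  proof (intro exI conjI allI)
    have "finite {k. Poly_Mapping.lookup u ((0 - m) - nmul k m) \<noteq> 0}"
      by (rule finite_coset[OF m])
    then show "finite {k. (1 / c) * Poly_Mapping.lookup u (0 - nmul (Suc k) m) \<noteq> 0}"
      using c by (simp add: algebra_simps)
    show "Poly_Mapping.lookup w (0 - nmul 0 m) =
        c * ((of_nat 0 + 2) * \<phi> m) * ((1 / c) * Poly_Mapping.lookup u (0 - nmul (Suc 0) m))"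
      unfolding w using c by simp
    fix k
    show "Poly_Mapping.lookup w (0 - nmul (Suc k) m) =
        (of_nat k + 1) * \<phi> m * ((1 / c) * Poly_Mapping.lookup u (0 - nmul (Suc k) m))
        + c * ((of_nat (Suc k) + 2) * \<phi> m) * ((1 / c) * Poly_Mapping.lookup u (0 - nmul (Suc (Suc k)) m))"
      unfolding w using c by (simp add: field_simps)
  qed
qed

text \<open>Such a coset has no natural starting point. Below the support of \<open>w\<close> the
  recurrence is homogeneous, so a nonzero coefficient of \<open>u\<close> would persist all the way
  down, against finite support. The walk can thus start at \<open>b - nmul N m\<close>, where
  \<open>N\<close> depends on \<open>w\<close> and not on \<open>c\<close>.\<close>

lemma generic_coset_vanishes:
  assumes m: "m \<noteq> 0" and u: "\<And>c. c \<noteq> 0 \<Longrightarrow> \<exists>u. test_image m w c u"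
    and b: "\<And>i::int. \<phi> b \<noteq> of_int i * \<phi> m"
  shows "Poly_Mapping.lookup w b = 0"
proof -
  obtain N where N: "\<And>k. N \<le> k \<Longrightarrow> Poly_Mapping.lookup w (b - nmul k m) = 0"
    using finite_coset(2)[OF m, of w b]
    by (metis (mono_tags, lifting) finite_nat_set_iff_bounded mem_Collect_eq not_le)
  have gen: "\<phi> (b - nmul k m) \<noteq> of_int i * \<phi> m" for k and i :: int
    using b[of "i + int k"] by (simp add: phi.diff phi_nmul algebra_simps)
  have "Poly_Mapping.lookup w ((b - nmul N m) + nmul N m) = 0"
  proof (rule upper_coset_vanishes[OF m])
    fix k
    show "\<phi> (b - nmul N m) + of_nat k * \<phi> m \<noteq> 0"
      using gen[of N "- int k"] by (simp add: eq_neg_iff_add_eq_0)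
    show "\<phi> (b - nmul N m) + of_nat k * \<phi> m \<noteq> \<phi> m"
      using gen[of N "1 - int k"] by (simp add: algebra_simps)
  next
    fix c :: complex
    assume c: "c \<noteq> 0"
    then obtain u where u: "test_image m w c u"
      using u by blast
    define v where "v k = Poly_Mapping.lookup u (b - nmul k m)" for k
    have step: "v (Suc k) \<noteq> 0" if "N \<le> k" "v k \<noteq> 0" for k
    proof -
      have "b - nmul k m \<noteq> m"
        using gen[of k 1] by auto
      moreover have "b - nmul k m - m = b - nmul (Suc k) m"
        by (simp add: algebra_simps)
      ultimately have "0 = (2 * \<phi> m - \<phi> (b - nmul k m)) * v (Suc k) - c * \<phi> (b - nmul k m) * v k"
        using u[unfolded test_image_def, rule_format, of "b - nmul k m"] N[OF that(1)]
        unfolding v_def by metis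
      then show ?thesis using that(2) c gen[of k 0] by auto
    qed
    have "v (Suc N) = 0"
    proof (rule ccontr)
      assume start: "v (Suc N) \<noteq> 0"
      have "v k \<noteq> 0" if "Suc N \<le> k" for k
        using that by (induction k rule: dec_induct) (use start step in auto)
      then have "{Suc N..} \<subseteq> {k. v k \<noteq> 0}"
        by auto
      then show False
        using finite_coset(2)[OF m, of u b] infinite_Ici[of "Suc N"] finite_subset
        unfolding v_def by blast
    qed
    moreover have "b - nmul N m - m = b - nmul (Suc N) m"
      by (simp add: algebra_simps)
    ultimately have "Poly_Mapping.lookup u (b - nmul N m - m) = 0"
      by (simp only: v_def)
    then show "\<exists>u. test_image m w c u \<and>
        (2 * \<phi> m - \<phi> (b - nmul N m)) * Poly_Mapping.lookup u (b - nmul N m - m) = 0"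
      using u by (metis mult_zero_right)
  qed
  then show ?thesis by simp
qed

text \<open>The factor \<open>c * \<phi> b\<close> vanishes at \<open>b = 0\<close> and
  \<open>2 * \<phi> m - \<phi> b\<close> at \<open>b = m + m\<close>. The multiples of
  \<open>m\<close> therefore split into a downward walk from \<open>0\<close> and an upward walk
  from \<open>m + m\<close>, with only \<open>m\<close> between them.\<close>

lemma test_image_diagonal:
  assumes m: "m \<noteq> 0" and u: "\<And>c. c \<noteq> 0 \<Longrightarrow> \<exists>u. test_image m w c u" and b: "b \<noteq> m"
  shows "Poly_Mapping.lookup w b = 0"
proof (cases "\<exists>i::int. \<phi> b = of_int i * \<phi> m")
  case True
  then obtain i :: int where i: "\<phi> b = of_int i * \<phi> m" by blast
  consider "i \<le> 0" | "i = 1" | "2 \<le> i" by linarith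
  then show ?thesis
  proof cases
    assume "i \<le> 0"
    then have "\<phi> b = \<phi> (0 - nmul (nat (- i)) m)"
      by (simp add: i phi.diff phi.minus phi.zero phi_nmul)
    then show ?thesis
      using lower_coset_vanishes[OF m u] by (simp add: phi_eq_iff)
  next
    assume "i = 1"
    then show ?thesis using i b by (simp add: phi_eq_iff)
  next
    assume "2 \<le> i"
    then have "\<phi> b = \<phi> ((m + m) + nmul (nat (i - 2)) m)"
      by (simp add: i phi.add phi_nmul algebra_simps)
    moreover have "Poly_Mapping.lookup w ((m + m) + nmul (nat (i - 2)) m) = 0"
    proof (rule upper_coset_vanishes[OF m])
      fix k
      have "\<phi> (m + m) + of_nat k * \<phi> m = of_nat (Suc (Suc k)) * \<phi> m"
        "\<phi> (m + m) + of_nat k * \<phi> m = \<phi> m + of_nat (Suc k) * \<phi> m"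
        by (simp_all add: phi.add algebra_simps)
      moreover have "of_nat (Suc j) * \<phi> m \<noteq> 0" for j
        using m by (simp only: mult_eq_0_iff of_nat_eq_0_iff phi_eq_0_iff) simp
      ultimately show "\<phi> (m + m) + of_nat k * \<phi> m \<noteq> 0" "\<phi> (m + m) + of_nat k * \<phi> m \<noteq> \<phi> m"
        by (metis, metis add_cancel_left_right)
    qed (use u in \<open>auto simp: phi.add\<close>)
    ultimately show ?thesis by (simp add: phi_eq_iff)
  qed
qed (use generic_coset_vanishes[OF m u] in blast)

section \<open>Local derivations in normal form\<close>

text \<open>In this form, subtracting an inner derivation merely changes \<open>u\<close>.\<close>

definition locally_standard :: "(('g \<Rightarrow>\<^sub>0 complex) \<Rightarrow> 'g \<Rightarrow>\<^sub>0 complex) \<Rightarrow> bool" where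
  "locally_standard \<Delta> \<longleftrightarrow> linear_endo_on pscale UNIV \<Delta> \<and>
     (\<forall>x. \<exists>u h. Modules.additive h \<and> \<Delta> x = bracket u x + grade h x)"

lemma locally_standard_diagonal:
  assumes \<Delta>: "locally_standard \<Delta>" and \<Delta>0: "\<Delta> (X 0) = 0"
  obtains g where "\<And>m. \<Delta> (X m) = Poly_Mapping.single m (g m)"
proof -
  have "Poly_Mapping.lookup (\<Delta> (X m)) b = 0" if b: "b \<noteq> m" for m b
  proof (cases "m = 0")
    case True
    then show ?thesis using \<Delta>0 by simp
  next
    case False
    have "\<exists>u. test_image m (\<Delta> (X m)) c u" for c
    proof -
      obtain u h where h: "Modules.additive h"
        and eq: "\<Delta> (X m + pscale c (X 0)) = bracket u (X m + pscale c (X 0)) + grade h (X m + pscale c (X 0))"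
        using \<Delta> unfolding locally_standard_def by blast
      have "\<Delta> (X m + pscale c (X 0)) = \<Delta> (X m) + pscale c (\<Delta> (X 0))"
        using \<Delta> by (simp add: locally_standard_def linear_endo_on_def del: single_one)
      also have "\<dots> = \<Delta> (X m)"
        by (simp add: \<Delta>0 pscale_def del: single_one)
      finally have eq': "\<Delta> (X m) =
          bracket u (X m) + pscale c (bracket u (X 0)) + grade h (X m + pscale c (X 0))"
        by (simp add: eq bracket_add_right bracket_pscale_right del: single_one)
      have "test_image m (\<Delta> (X m)) c u"
        unfolding test_image_def eq'
        by (auto simp: lookup_add lookup_bracket_X lookup_pscale lookup_grade lookup_single when_def
            phi.zero Modules.additive.zero[OF h] algebra_simps simp del: single_one)
      then show ?thesis by blast
    qed
    then show ?thesis
      using test_image_diagonal[OF False _ b] by blast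
  qed
  then have "\<Delta> (X m) = Poly_Mapping.single m (Poly_Mapping.lookup (\<Delta> (X m)) m)" for m
    by (intro poly_mapping_eqI) (auto simp: lookup_single when_def)
  then show thesis by (rule that)
qed

text \<open>Bounding the support of \<open>u'\<close> from above and below confines it to exponent
  \<open>0\<close>. The freedom to subtract multiples of \<open>x\<close> normalizes
  \<open>u\<close> at \<open>M\<close> only, so the opposite end \<open>M'\<close> needs the
  assumption \<open>bottom\<close>.\<close>

lemma diagonal_additive_on:
  fixes \<rho> :: "'g \<Rightarrow> real"
  assumes \<rho>: "Modules.additive \<rho>" "inj \<rho>"
    and \<Delta>: "locally_standard \<Delta>" and g: "\<And>m. \<Delta> (X m) = Poly_Mapping.single m (g m)"
    and S: "finite S" "M \<in> S" "M' \<in> S" "\<And>m. m \<in> S \<Longrightarrow> \<rho> m \<le> \<rho> M" "\<And>m. m \<in> S \<Longrightarrow> \<rho> M' \<le> \<rho> m"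
    and bottom: "\<And>u. Poly_Mapping.lookup u M = 0 \<Longrightarrow>
      (\<And>b. b \<notin> S \<Longrightarrow> (\<Sum>m\<in>S. (2 * \<phi> m - \<phi> b) * Poly_Mapping.lookup u (b - m)) = 0) \<Longrightarrow>
      Poly_Mapping.lookup u M' = 0 \<or> 0 \<le> \<rho> M'"
  obtains k where "Modules.additive k" "\<And>m. m \<in> S \<Longrightarrow> g m = k m"
proof -
  define x where "x = (\<Sum>m\<in>S. X m)"
  obtain u h where h: "Modules.additive h" and eq: "\<Delta> x = bracket u x + grade h x"
    using \<Delta> unfolding locally_standard_def by blast
  have lookup_x: "Poly_Mapping.lookup x b = (if b \<in> S then 1 else 0)" for b
    using S(1) by (auto simp: x_def lookup_sum lookup_single when_def)
  \<comment> \<open>Since \<open>[x, x] = 0\<close>, the coefficient of \<open>u\<close> at \<open>M\<close> can be removed.\<close>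
  define u' where "u' = u - pscale (Poly_Mapping.lookup u M) x"
  have u'M: "Poly_Mapping.lookup u' M = 0"
    using S(2) by (simp add: u'_def lookup_minus lookup_pscale lookup_x)
  have u'x: "bracket u' x = bracket u x"
    by (simp add: u'_def bracket_diff_left bracket_pscale_left bracket_self)
       (simp add: pscale_def)
  have \<Delta>_sum: "\<Delta> (\<Sum>m\<in>T. X m) = (\<Sum>m\<in>T. \<Delta> (X m))" for T
  proof (induction T rule: infinite_finite_induct)
    case (insert a T)
    then show ?case
      using \<Delta> by (simp add: locally_standard_def linear_endo_on_def)
  next
    case empty
    obtain v k where "\<Delta> 0 = bracket v 0 + grade k 0"
      using \<Delta> unfolding locally_standard_def by blast
    then show ?case by (simp add: bracket_zero_right)
  next
    case (infinite T)
    obtain v k where "\<Delta> 0 = bracket v 0 + grade k 0"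
      using \<Delta> unfolding locally_standard_def by blast
    with infinite show ?case by (simp add: bracket_zero_right)
  qed
  have coeff: "(if b \<in> S then g b else 0) =
      (\<Sum>m\<in>S. (2 * \<phi> m - \<phi> b) * Poly_Mapping.lookup u' (b - m)) + (if b \<in> S then h b else 0)" for b
  proof -
    have "(if b \<in> S then g b else 0) = Poly_Mapping.lookup (\<Delta> x) b"
      using S(1) by (simp add: x_def \<Delta>_sum g lookup_sum lookup_single when_def)
    also have "\<dots> = Poly_Mapping.lookup (bracket u' x) b + h b * Poly_Mapping.lookup x b"
      by (simp add: eq u'x lookup_add lookup_grade)
    also have "Poly_Mapping.lookup (bracket u' x) b =
        (\<Sum>m\<in>S. (2 * \<phi> m - \<phi> b) * Poly_Mapping.lookup u' (b - m))"
      by (simp add: x_def bracket_sum_right lookup_sum lookup_bracket_X)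
    finally show ?thesis by (simp add: lookup_x)
  qed
  have vanish: "(\<Sum>m\<in>S. (2 * \<phi> m - \<phi> b) * Poly_Mapping.lookup u' (b - m)) = 0" if "b \<notin> S" for b
    using coeff[of b] that by simp
  have supp: "Poly_Mapping.lookup u' p = 0" if "p \<noteq> 0" for p
  proof (rule ccontr)
    assume p: "Poly_Mapping.lookup u' p \<noteq> 0"
    have "\<rho> p \<le> 0"
      by (rule max_support_bound[OF \<rho> additive_phi inj_phi S(1,2,4) vanish _ p]) (use u'M in auto)
    \<comment> \<open>The same bound for the reversed order, with \<open>M'\<close> as the greatest
      element of \<open>S\<close>.\<close>
    moreover have "- \<rho> p \<le> 0"
    proof (rule max_support_bound[OF _ _ additive_phi inj_phi S(1,3) _ vanish _ p])
      show "Modules.additive (\<lambda>a. - \<rho> a)"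
        using Modules.additive.add[OF \<rho>(1)] by unfold_locales simp
      show "inj (\<lambda>a. - \<rho> a)"
        using \<rho>(2) by (simp add: inj_def)
      show "Poly_Mapping.lookup u' M' = 0 \<or> - \<rho> M' \<le> 0"
        using bottom[OF u'M vanish] by simp
    qed (use S(5) in simp_all)
    ultimately have "\<rho> p = \<rho> 0"
      by (simp add: Modules.additive.zero[OF \<rho>(1)])
    then show False
      using \<rho>(2) that by (auto dest: injD)
  qed
  \<comment> \<open>What remains of \<open>u'\<close> is a multiple of \<open>X 0\<close>, which
    acts on \<open>X a\<close> by \<open>\<phi> a\<close>.\<close>
  define k where "k a = Poly_Mapping.lookup u' 0 * \<phi> a + h a" for a
  have "Modules.additive k"
    by unfold_locales (simp add: k_def phi.add Modules.additive.add[OF h] algebra_simps)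
  moreover have "g b = k b" if b: "b \<in> S" for b
  proof -
    have "(\<Sum>m\<in>S - {b}. (2 * \<phi> m - \<phi> b) * Poly_Mapping.lookup u' (b - m)) = 0"
      by (intro sum.neutral) (auto simp: supp)
    then show ?thesis
      using coeff[of b] b S(1) by (simp add: sum.remove[of S b] k_def)
  qed
  ultimately show thesis using that by blast
qed

lemma diagonal_additive:
  assumes \<Delta>: "locally_standard \<Delta>" and g: "\<And>m. \<Delta> (X m) = Poly_Mapping.single m (g m)"
    and g0: "g 0 = 0"
  shows "Modules.additive g"
proof -
  obtain \<rho> :: "'g \<Rightarrow> real" where \<rho>: "Modules.additive \<rho>" "inj \<rho>"
    using additive_real_embedding[OF additive_phi inj_phi] by blast
  interpret \<rho>: Modules.additive \<rho> by fact
  have \<rho>0: "\<rho> a = 0 \<longleftrightarrow> a = 0" for a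
    using \<rho>(2) \<rho>.zero by (metis injD)
  have pos: "g (a + b) = g a + g b" if ab: "\<rho> a > 0" "\<rho> b > 0" for a b
  proof -
    obtain M' where M': "M' \<in> {a, b, a + b}" "\<And>m. m \<in> {a, b, a + b} \<Longrightarrow> \<rho> M' \<le> \<rho> m"
      using ab by (cases "\<rho> a \<le> \<rho> b") (force simp: \<rho>.add)+
    obtain k where k: "Modules.additive k" "\<And>m. m \<in> {a, b, a + b} \<Longrightarrow> g m = k m"
    proof (rule diagonal_additive_on[OF \<rho> \<Delta> g, of "{a, b, a + b}" "a + b" M'])
      show "\<rho> m \<le> \<rho> (a + b)" if "m \<in> {a, b, a + b}" for m
        using that ab by (auto simp: \<rho>.add)
      show "Poly_Mapping.lookup u M' = 0 \<or> 0 \<le> \<rho> M'" for u :: "'g \<Rightarrow>\<^sub>0 complex"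
        using M'(1) ab by (auto simp: \<rho>.add)
    qed (use M' in simp_all)
    then show ?thesis by (simp add: Modules.additive.add)
  qed
  have neg_pos: "g (- a) = - g a" if a: "\<rho> a > 0" for a
  proof -
    \<comment> \<open>Here \<open>M' = - a\<close> is negative, so its coefficient must vanish. The
      equation at exponent \<open>0\<close> reads \<open>2 * \<phi> a\<close> times the difference
      of the coefficients at \<open>- a\<close> and \<open>a\<close>, and the latter is
      \<open>0\<close>.\<close>
    have "a \<noteq> 0" "a \<noteq> - a"
      using a \<rho>.zero \<rho>.minus[of a] by auto
    have bottom: "Poly_Mapping.lookup u (- a) = 0"
      if "Poly_Mapping.lookup u a = 0"
        "\<And>b. b \<notin> {a, - a} \<Longrightarrow>
          (\<Sum>m\<in>{a, - a}. (2 * \<phi> m - \<phi> b) * Poly_Mapping.lookup u (b - m)) = 0" for u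
      using that(1) that(2)[of 0] \<open>a \<noteq> 0\<close> \<open>a \<noteq> - a\<close> by (simp add: phi.zero phi_eq_0_iff)
    obtain k where k: "Modules.additive k" "\<And>m. m \<in> {a, - a} \<Longrightarrow> g m = k m"
    proof (rule diagonal_additive_on[OF \<rho> \<Delta> g, of "{a, - a}" a "- a"])
      show "\<rho> m \<le> \<rho> a" "\<rho> (- a) \<le> \<rho> m" if "m \<in> {a, - a}" for m
        using that a by (auto simp: \<rho>.minus)
    qed (use bottom in simp_all)
    then show ?thesis by (simp add: Modules.additive.minus)
  qed
  have neg: "g (- a) = - g a" for a
    using neg_pos[of a] neg_pos[of "- a"] \<rho>0[of a] g0
    by (cases "\<rho> a" "0 :: real" rule: linorder_cases) (auto simp: \<rho>.minus)
  have mixed: "g (a + b) = g a + g b" if ab: "\<rho> a > 0" "\<rho> b < 0" for a b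
  proof (cases "\<rho> (a + b)" "0 :: real" rule: linorder_cases)
    case less
    \<comment> \<open>Both \<open>- (a + b)\<close> and \<open>a\<close> are positive, and their sum
      is \<open>- b\<close>.\<close>
    then have "g (- (a + b) + a) = g (- (a + b)) + g a"
      using ab by (intro pos) (simp_all add: \<rho>.minus \<rho>.add \<rho>.diff)
    then show ?thesis using neg[of "a + b"] by (simp add: neg algebra_simps)
  next
    case equal
    then have "b = - a"
      by (simp add: \<rho>0 eq_neg_iff_add_eq_0 add.commute)
    then show ?thesis by (simp add: neg g0)
  next
    case greater
    then have "g ((a + b) + - b) = g (a + b) + g (- b)"
      using ab by (intro pos) (simp_all add: \<rho>.minus \<rho>.add \<rho>.diff)
    then show ?thesis by (simp add: neg)
  qed
  show ?thesis
  proof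
    fix a b :: 'g
    consider "a = 0" | "b = 0" | "\<rho> a > 0" "\<rho> b > 0" | "\<rho> a < 0" "\<rho> b < 0"
      | "\<rho> a > 0" "\<rho> b < 0" | "\<rho> a < 0" "\<rho> b > 0"
      using \<rho>0 by (metis linorder_neqE_linordered_idom)
    then show "g (a + b) = g a + g b"
    proof cases
      case 4
      then have "g (- a + - b) = g (- a) + g (- b)"
        by (intro pos) (simp_all add: \<rho>.minus \<rho>.add \<rho>.diff)
      then have "- g (a + b) = - (g a + g b)"
        using neg[of "a + b"] by (simp add: neg)
      then show ?thesis by (simp only: neg_equal_iff_equal)
    next
      case 6
      then show ?thesis using mixed[of b a] by (simp add: add.commute)
    qed (simp_all add: g0 pos mixed)
  qed
qed

lemma local_derivation_imp_derivation:
  assumes \<Delta>: "local_derivation_on pscale bracket UNIV \<Delta>"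
  shows "derivation_on pscale bracket UNIV \<Delta>"
proof -
  have lin: "linear_endo_on pscale UNIV \<Delta>"
    using \<Delta> by (simp add: local_derivation_on_def)
  have std: "\<exists>u h. Modules.additive h \<and> \<Delta> x = bracket u x + grade h x" for x
  proof -
    obtain D where "derivation_on pscale bracket UNIV D" "\<Delta> x = D x"
      using \<Delta> by (auto simp: local_derivation_on_def)
    then show ?thesis by (metis derivation_classification)
  qed
  \<comment> \<open>As \<open>h 0 = 0\<close>, the grading term vanishes at \<open>X 0\<close>;
    subtracting the bracket with \<open>v\<close> therefore makes the map kill
    \<open>X 0\<close>.\<close>
  obtain v h where h: "Modules.additive h" and v: "\<Delta> (X 0) = bracket v (X 0) + grade h (X 0)"
    using std by blast
  define E where "E x = \<Delta> x - bracket v x" for x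
  have E: "locally_standard E"
    unfolding locally_standard_def
  proof (intro conjI allI)
    show "linear_endo_on pscale UNIV E"
      using lin
      by (simp add: linear_endo_on_def E_def bracket_add_right bracket_pscale_right)
         (simp add: pscale_def algebra_simps)
    fix x
    obtain u k where "Modules.additive k" "\<Delta> x = bracket u x + grade k x"
      using std by blast
    then have "Modules.additive k \<and> E x = bracket (u - v) x + grade k x"
      by (simp add: E_def bracket_diff_left)
    then show "\<exists>u h. Modules.additive h \<and> E x = bracket u x + grade h x"
      by blast
  qed
  have E0: "E (X 0) = 0"
    using v by (simp add: E_def grade_single Modules.additive.zero[OF h] del: single_one)
  obtain g where g: "\<And>m. E (X m) = Poly_Mapping.single m (g m)"
    using locally_standard_diagonal[OF E E0] by blast
  have "g 0 = 0"
    using E0 g[of 0] by (metis lookup_single_eq lookup_zero)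
  then have add_g: "Modules.additive g"
    by (rule diagonal_additive[OF E g])
  have "E x = grade g x" for x
  proof (rule linear_endo_on_eqI[where S = E and T = "grade g"])
    show "linear_endo_on pscale UNIV (grade g)"
      using linear_bracket_grade[of 0 g] by (simp add: bracket_def)
    show "linear_endo_on pscale UNIV E"
      using E by (simp add: locally_standard_def)
  qed (simp add: g grade_single)
  then have "\<Delta> = (\<lambda>x. bracket v x + grade g x)"
    by (auto simp: E_def fun_eq_iff algebra_simps)
  then show ?thesis
    using derivation_bracket_grade[OF add_g] by simp
qed

end

section \<open>Transport along injective homomorphisms\<close>

lemma linear_endo_on_transport:
  fixes E :: "'v::ab_group_add \<Rightarrow> 'w::ab_group_add"
  assumes "inj E" and "\<And>x y. E (x + y) = E x + E y" and "\<And>c x. E (s c x) = s' c (E x)"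
    and "\<And>x. D' (E x) = E (D x)"
  shows "linear_endo_on s' (range E) D' \<longleftrightarrow> linear_endo_on s UNIV D"
  using assms by (simp add: linear_endo_on_def inj_eq flip: assms(2,3))

lemma derivation_on_transport:
  fixes E :: "'v::ab_group_add \<Rightarrow> 'w::ab_group_add"
  assumes "inj E" and add: "\<And>x y. E (x + y) = E x + E y"
    and scale: "\<And>c x. E (s c x) = s' c (E x)" and mult: "\<And>x y. E (m x y) = m' (E x) (E y)"
    and D: "\<And>x. D' (E x) = E (D x)"
  shows "derivation_on s' m' (range E) D' \<longleftrightarrow> derivation_on s m UNIV D"
  using \<open>inj E\<close>
  by (simp add: derivation_on_def linear_endo_on_transport[where E = E and D = D and s = s and s' = s',
        OF \<open>inj E\<close> add scale D] D inj_eq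
      flip: add mult)

text \<open>Each pointwise derivation preserves \<open>range E\<close>, so it pulls back along
  \<open>inv E\<close>; its values elsewhere do not matter.\<close>

lemma local_derivation_on_transport:
  fixes E :: "'v::ab_group_add \<Rightarrow> 'w::ab_group_add"
  assumes "inj E" and add: "\<And>x y. E (x + y) = E x + E y"
    and scale: "\<And>c x. E (s c x) = s' c (E x)" and mult: "\<And>x y. E (m x y) = m' (E x) (E y)"
    and \<Delta>: "\<And>x. \<Delta>' (E x) = E (\<Delta> x)" and local: "local_derivation_on s' m' (range E) \<Delta>'"
  shows "local_derivation_on s m UNIV \<Delta>"
  unfolding local_derivation_on_def
proof (intro conjI ballI)
  show "linear_endo_on s UNIV \<Delta>"
    using local linear_endo_on_transport[where E = E and D = \<Delta> and s = s and s' = s',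
        OF \<open>inj E\<close> add scale \<Delta>]
    by (simp add: local_derivation_on_def)
  fix x
  obtain D' where D': "derivation_on s' m' (range E) D'" "\<Delta>' (E x) = D' (E x)"
    using local by (auto simp: local_derivation_on_def)
  define D where "D = inv E \<circ> D' \<circ> E"
  have D: "D' (E y) = E (D y)" for y
    using D'(1) by (simp add: D_def f_inv_into_f derivation_on_def linear_endo_on_def)
  have "derivation_on s m UNIV D"
    using D'(1) derivation_on_transport[where E = E and D = D and m = m and m' = m' and s = s and s' = s',
        OF \<open>inj E\<close> add scale mult D] by simp
  moreover have "\<Delta> x = D x"
    using D'(2) \<open>inj E\<close> by (simp add: D \<Delta> inj_eq)
  ultimately show "\<exists>D. derivation_on s m UNIV D \<and> \<Delta> x = D x"
    by blast
qed

section \<open>The generalized Virasoro algebra as an instance\<close>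

definition pairing :: "complex ^ 'n \<Rightarrow> int ^ 'n \<Rightarrow> complex" where
  "pairing \<mu> \<alpha> = (\<Sum>i\<in>UNIV. \<mu> $ i * of_int (\<alpha> $ i))"

text \<open>Genericity says that the additive map has trivial kernel, which amounts to
  injectivity.\<close>

lemma rank_one_witt_pairing:
  fixes \<mu> :: "complex ^ 'n::finite"
  assumes "generic \<mu>"
  shows "rank_one_witt (pairing \<mu>)"
proof (rule rank_one_witt.intro)
  have add: "pairing \<mu> (a + b) = pairing \<mu> a + pairing \<mu> b" for a b
    by (simp add: pairing_def algebra_simps sum.distrib)
  then show "Modules.additive (pairing \<mu>)"
    by unfold_locales
  have nz: "pairing \<mu> c \<noteq> 0" if "c \<noteq> 0" for c
    using assms that by (simp add: generic_def pairing_def)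
  have "a = b" if "pairing \<mu> a = pairing \<mu> b" for a b
    using that add[of "a - b" b] nz[of "a - b"] by auto
  then show "inj (pairing \<mu>)"
    by (rule injI)
  show "\<exists>a :: int ^ 'n. a \<noteq> 0"
    by (rule exI[of _ "\<chi> i. 1"]) (simp add: vec_eq_iff)
qed

lemma dmu_eq_grade: "dmu \<mu> f = grade (pairing \<mu>) f"
proof (induction f rule: laurent_induct)
  case (2 \<alpha> c)
  show ?case
    by (rule poly_mapping_eqI)
       (simp add: dmu_apply ldeg_single mult_single grade_single lookup_sum lookup_single
          pairing_def sum_distrib_right when_def mult.assoc)
qed (simp_all add: dmu_add grade_add, simp add: dmu_apply ldeg_zero)

theorem corollary3p8:
  fixes \<mu> :: "complex ^ 'n::finite"
    and \<Delta> :: "('n laurent \<Rightarrow> 'n laurent) \<Rightarrow> ('n laurent \<Rightarrow> 'n laurent)"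
  assumes "generic \<mu>"
    and "local_derivation_on opscale commutator (gen_virasoro \<mu>) \<Delta>"
  shows "derivation_on opscale commutator (gen_virasoro \<mu>) \<Delta>"
proof -
  interpret rank_one_witt "pairing \<mu>"
    by (rule rank_one_witt_pairing[OF assms(1)])
  define E :: "'n laurent \<Rightarrow> 'n laurent \<Rightarrow> 'n laurent" where "E a = (\<lambda>f. a * dmu \<mu> f)" for a
  have range_E: "gen_virasoro \<mu> = range E"
    by (auto simp: gen_virasoro_def E_def)
  \<comment> \<open>Evaluating an operator at \<open>X \<alpha>\<close> multiplies its coefficient
    by a monomial with the nonzero scalar \<open>pairing \<mu> \<alpha>\<close>, so the operator
    determines the coefficient.\<close>
  obtain \<alpha> :: "int ^ 'n" where \<alpha>: "\<alpha> \<noteq> 0"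
    using nontrivial by blast
  have "a = b" if "E a = E b" for a b
  proof (rule poly_mapping_eqI)
    fix \<beta>
    have "Poly_Mapping.lookup (E a (X \<alpha>)) (\<beta> + \<alpha>) = Poly_Mapping.lookup (E b (X \<alpha>)) (\<beta> + \<alpha>)"
      by (simp add: that)
    then show "Poly_Mapping.lookup a \<beta> = Poly_Mapping.lookup b \<beta>"
      using \<alpha> by (simp add: E_def dmu_eq_grade grade_single lookup_mult_single phi_eq_0_iff)
  qed
  then have inj: "inj E"
    by (rule injI)
  have add: "E (a + b) = E a + E b" for a b
    by (auto simp: E_def algebra_simps)
  have scale: "E (pscale c a) = opscale c (E a)" for c a
    by (simp add: E_def opscale_def lscale_conv_mult pscale_def mult.assoc)
  have mult: "E (bracket a b) = commutator (E a) (E b)" for a b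
    by (rule ext)
       (simp add: E_def commutator_def dmu_eq_grade bracket_def grade_mult[OF additive_phi] algebra_simps)
  define \<Delta>' where "\<Delta>' = inv E \<circ> \<Delta> \<circ> E"
  have \<Delta>': "\<Delta> (E a) = E (\<Delta>' a)" for a
    using assms(2)
    by (simp add: \<Delta>'_def f_inv_into_f range_E local_derivation_on_def linear_endo_on_def)
  have "local_derivation_on pscale bracket UNIV \<Delta>'"
    using assms(2) local_derivation_on_transport
      [where E = E and m = bracket and m' = commutator and s = pscale and s' = opscale
        and \<Delta> = \<Delta>' and \<Delta>' = \<Delta>, OF inj add scale mult \<Delta>']
    by (simp add: range_E)
  then have "derivation_on pscale bracket UNIV \<Delta>'"
    by (rule local_derivation_imp_derivation)
  then show ?thesis
    using derivation_on_transport
      [where E = E and m = bracket and m' = commutator and s = pscale and s' = opscale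
        and D = \<Delta>' and D' = \<Delta>, OF inj add scale mult \<Delta>']
    by (simp add: range_E)
qed

end
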